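(* Let $A^{(1)},\dots,A^{(K)}\in\mathbb{R}^{n\times n}$ be symmetric matrices, let $\boldsymbol{p}_k=[\underline{p}_k,\overline{p}_k]$, $k=1,\dots,K$, be compact real intervals, and let $\boldsymbol{p}=\boldsymbol{p}_1\times\dots\times\boldsymbol{p}_K$. For $p\in\mathbb{R}^K$ let $A(p)=\sum_{k=1}^K A^{(k)}p_k$. The following are equivalent: (1) the parametric matrix $A(p)$, $p\in\boldsymbol{p}$, is strongly positive definite; (2) $A(p)$ is positive definite for each $p$ such that $p_k\in\{\underline{p}_k,\overline{p}_k\}$ for all $k=1,\dots,K$; (3) $x^TA(p^c)x-\sum_{k=1}^K|x^TA^{(k)}x|\cdot p^\Delta_k>0$ for each $x\in\mathbb{R}^n$ with $x\neq 0$.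
   Context: The parametric matrix $A(p)$, $p\in\boldsymbol{p}$, is called strongly positive definite if $A(p)$ is positive definite for each $p\in\boldsymbol{p}$. For intervals $\boldsymbol{p}_k=[\underline{p}_k,\overline{p}_k]$ with $\underline{p}_k\le\overline{p}_k$, the midpoint vector $p^c$ and radius vector $p^\Delta$ are given by $p^c_k=\frac12(\underline{p}_k+\overline{p}_k)$ and $p^\Delta_k=\frac12(\overline{p}_k-\underline{p}_k)$, $k=1,\dots,K$. Positive definite refers to real symmetric matrices. *)

theory Defs
  imports "HOL-Analysis.Analysis"
begin

definition positive_definite :: "real ^ 'n ^ 'n \<Rightarrow> bool" where
  "positive_definite M \<longleftrightarrow>
     transpose M = M \<and> (\<forall>x::real ^ 'n. x \<noteq> 0 \<longrightarrow> x \<bullet> (M *v x) > 0)"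

definition parametric_matrix :: "('k::finite \<Rightarrow> real ^ 'n ^ 'n) \<Rightarrow> real ^ 'k \<Rightarrow> real ^ 'n ^ 'n" where
  "parametric_matrix A p = (\<Sum>k\<in>UNIV. p $ k *\<^sub>R A k)"

definition strongly_positive_definite ::
  "('k::finite \<Rightarrow> real ^ 'n ^ 'n) \<Rightarrow> (real ^ 'k) set \<Rightarrow> bool" where
  "strongly_positive_definite A P \<longleftrightarrow> (\<forall>p\<in>P. positive_definite (parametric_matrix A p))"

definition interval_mid :: "real ^ 'k \<Rightarrow> real ^ 'k \<Rightarrow> real ^ 'k" where
  "interval_mid lo hi = (\<chi> k. (lo $ k + hi $ k) / 2)"

definition interval_rad :: "real ^ 'k \<Rightarrow> real ^ 'k \<Rightarrow> real ^ 'k" where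
  "interval_rad lo hi = (\<chi> k. (hi $ k - lo $ k) / 2)"

end

theory Submission
  imports Defs
begin

text \<open>
  For a fixed vector \<open>x\<close> the quadratic form \<open>x \<bullet> (A(p) *v x)\<close> is linear in the
  parameter \<open>p\<close>, with coefficients \<open>x \<bullet> (A k *v x)\<close>
  (\<open>quadratic_form_parametric_matrix\<close>).  A linear function on a box attains its minimum at a
  vertex: each coordinate independently takes the lower endpoint when its coefficient is
  nonnegative and the upper endpoint otherwise.  Written in terms of midpoint and radius, the
  minimum contributed by a coordinate with coefficient \<open>c\<close> is the midpoint times \<open>c\<close> minus
  the radius times \<open>\<bar>c\<bar>\<close>, so the left-hand side of the inequality in the third condition is
  precisely the minimum over the box (\<open>centred_form_le\<close>, \<open>centred_form_attained\<close>).

  Hence the third condition bounds the form from below by a positive number on the whole box,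
  and the vertices, being points of the box, inherit positive definiteness.  Conversely, the
  minimising vertex for a given \<open>x\<close> turns the second condition into the third.  The vertex
  depends on \<open>x\<close>, which is harmless since the second condition covers all vertices.
\<close>

lemma transpose_parametric_matrix:
  assumes "\<And>k. transpose (A k) = A k"
  shows "transpose (parametric_matrix A p) = parametric_matrix A p"
proof -
  have "A k $ i $ j = A k $ j $ i" for k i j
    using assms[of k] by (metis transpose_def vec_lambda_beta)
  then show ?thesis
    by (simp add: parametric_matrix_def transpose_def vec_eq_iff)
qed

lemma sum_matrix_vector_mult:
  fixes M :: "'k \<Rightarrow> real ^ 'n ^ 'm"
  shows "(\<Sum>k\<in>S. M k) *v x = (\<Sum>k\<in>S. M k *v x)"
  by (induction S rule: infinite_finite_induct)
     (simp_all add: matrix_vector_mult_add_rdistrib)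

lemma quadratic_form_parametric_matrix:
  "x \<bullet> (parametric_matrix A p *v x) = (\<Sum>k\<in>UNIV. p $ k * (x \<bullet> (A k *v x)))"
  unfolding parametric_matrix_def sum_matrix_vector_mult inner_sum_right
    scaleR_matrix_vector_assoc[symmetric] inner_scaleR_right by (rule refl)

text \<open>
  Moving away from the midpoint by at most the radius changes each term by at most the radius
  times the absolute value of its coefficient.
\<close>

lemma centred_form_le:
  fixes c :: "'k::finite \<Rightarrow> real"
  assumes "p \<in> cbox lo hi"
  shows "(\<Sum>k\<in>UNIV. interval_mid lo hi $ k * c k) - (\<Sum>k\<in>UNIV. \<bar>c k\<bar> * interval_rad lo hi $ k)
           \<le> (\<Sum>k\<in>UNIV. p $ k * c k)"
proof -
  have "interval_mid lo hi $ k * c k - \<bar>c k\<bar> * interval_rad lo hi $ k \<le> p $ k * c k" for k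
  proof -
    have "\<bar>interval_mid lo hi $ k - p $ k\<bar> \<le> interval_rad lo hi $ k"
    proof -
      have "lo $ k \<le> p $ k" "p $ k \<le> hi $ k"
        using assms by (simp_all add: mem_box_cart)
      then show ?thesis
        unfolding interval_mid_def interval_rad_def vec_lambda_beta
        by (intro abs_leI) (simp_all add: field_simps)
    qed
    then have "\<bar>interval_mid lo hi $ k - p $ k\<bar> * \<bar>c k\<bar> \<le> interval_rad lo hi $ k * \<bar>c k\<bar>"
      by (rule mult_right_mono) simp
    then have "(interval_mid lo hi $ k - p $ k) * c k \<le> interval_rad lo hi $ k * \<bar>c k\<bar>"
      unfolding abs_mult[symmetric] by (rule abs_le_D1)
    then show ?thesis
      by (simp add: algebra_simps)
  qed
  then show ?thesis
    unfolding sum_subtractf[symmetric] by (rule sum_mono)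
qed

text \<open>
  The vertex that selects in each coordinate the endpoint favoured by the sign of the
  coefficient makes every term of the lower bound sharp at once.
\<close>

lemma centred_form_attained:
  fixes c :: "'k::finite \<Rightarrow> real"
  obtains p where "\<And>k. p $ k \<in> {lo $ k, hi $ k}"
    and "(\<Sum>k\<in>UNIV. p $ k * c k)
           = (\<Sum>k\<in>UNIV. interval_mid lo hi $ k * c k)
             - (\<Sum>k\<in>UNIV. \<bar>c k\<bar> * interval_rad lo hi $ k)"
proof
  let ?p = "\<chi> k. if c k \<ge> 0 then lo $ k else hi $ k"
  show "?p $ k \<in> {lo $ k, hi $ k}" for k
    by simp
  have "?p $ k * c k = interval_mid lo hi $ k * c k - \<bar>c k\<bar> * interval_rad lo hi $ k" for k
    by (simp add: interval_mid_def interval_rad_def field_simps)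
  then show "(\<Sum>k\<in>UNIV. ?p $ k * c k)
      = (\<Sum>k\<in>UNIV. interval_mid lo hi $ k * c k) - (\<Sum>k\<in>UNIV. \<bar>c k\<bar> * interval_rad lo hi $ k)"
    by (simp only: sum_subtractf)
qed

theorem theorem7:
  fixes A :: "'k::finite \<Rightarrow> real ^ 'n ^ 'n"
    and lo hi :: "real ^ 'k"
  assumes sym: "\<And>k. transpose (A k) = A k"
    and le: "\<And>k. lo $ k \<le> hi $ k"
  shows "(strongly_positive_definite A (cbox lo hi) \<longleftrightarrow>
            (\<forall>p::real ^ 'k. (\<forall>k. p $ k \<in> {lo $ k, hi $ k}) \<longrightarrow>
               positive_definite (parametric_matrix A p))) \<and>
         (strongly_positive_definite A (cbox lo hi) \<longleftrightarrow>
            (\<forall>x::real ^ 'n. x \<noteq> 0 \<longrightarrow>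
               x \<bullet> (parametric_matrix A (interval_mid lo hi) *v x)
                 - (\<Sum>k\<in>UNIV. \<bar>x \<bullet> (A k *v x)\<bar> * interval_rad lo hi $ k) > 0))"
    (is "(?box \<longleftrightarrow> ?vertices) \<and> (?box \<longleftrightarrow> ?centred)")
proof -
  have "?vertices" if ?box
  proof (intro allI impI)
    fix p :: "real ^ 'k"
    assume p: "\<forall>k. p $ k \<in> {lo $ k, hi $ k}"
    have "lo $ k \<le> p $ k \<and> p $ k \<le> hi $ k" for k
      using spec[OF p, of k] le[of k] by auto
    then have "p \<in> cbox lo hi"
      by (simp add: mem_box_cart)
    then show "positive_definite (parametric_matrix A p)"
      using that by (simp add: strongly_positive_definite_def)
  qed
  moreover have "?centred" if vertices: ?vertices
  proof (intro allI impI)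
    fix x :: "real ^ 'n"
    assume "x \<noteq> 0"
    obtain p where p: "\<And>k. p $ k \<in> {lo $ k, hi $ k}"
      and min: "(\<Sum>k\<in>UNIV. p $ k * (x \<bullet> (A k *v x)))
        = (\<Sum>k\<in>UNIV. interval_mid lo hi $ k * (x \<bullet> (A k *v x)))
          - (\<Sum>k\<in>UNIV. \<bar>x \<bullet> (A k *v x)\<bar> * interval_rad lo hi $ k)"
      using centred_form_attained[of lo hi "\<lambda>k. x \<bullet> (A k *v x)"] by blast
    have "positive_definite (parametric_matrix A p)"
      using vertices p by blast
    then have "x \<bullet> (parametric_matrix A p *v x) > 0"
      using \<open>x \<noteq> 0\<close> by (simp add: positive_definite_def)
    then show "x \<bullet> (parametric_matrix A (interval_mid lo hi) *v x)
        - (\<Sum>k\<in>UNIV. \<bar>x \<bullet> (A k *v x)\<bar> * interval_rad lo hi $ k) > 0"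
      unfolding quadratic_form_parametric_matrix min .
  qed
  moreover have "?box" if centred: ?centred
    unfolding strongly_positive_definite_def positive_definite_def
  proof (intro ballI conjI allI impI)
    fix p
    assume p: "p \<in> cbox lo hi"
    show "transpose (parametric_matrix A p) = parametric_matrix A p"
      using sym by (rule transpose_parametric_matrix)
    fix x :: "real ^ 'n"
    assume "x \<noteq> 0"
    then show "x \<bullet> (parametric_matrix A p *v x) > 0"
      using centred centred_form_le[OF p, of "\<lambda>k. x \<bullet> (A k *v x)"]
      unfolding quadratic_form_parametric_matrix by (blast intro: less_le_trans)
  qed
  ultimately show ?thesis
    by blast
qed

end
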